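(* Let $k\ge1$, let $e_1,\ldots,e_t$ be positive integers, and let $0\leq r\leq k$. Then \[ R_<\big(M_{e_1}^{k,r},\ldots,M_{e_t}^{k,r}\big)= k\left(1+\sum_{i=1}^t (e_i-1)\right). \]
   Context: An ordered $k$-uniform hypergraph is a $k$-uniform hypergraph with a totally ordered vertex set. An ordered hypergraph $G$ is contained in an ordered hypergraph $H$ if there is an injective order-preserving map $V(G)\to V(H)$ sending every edge of $G$ to an edge of $H$. $K_N^k$ is the complete $k$-uniform hypergraph on $[N]=\{1,\dots,N\}$ with the natural order. For ordered $k$-uniform hypergraphs $G_1,\dots,G_t$, $R_<(G_1,\dots,G_t)$ is the least $N$ such that for every coloring $c:E(K_N^k)\to[t]$ there is a color $j$ such that the hypergraph formed by the edges of color $j$ contains $G_j$. For $0\le r\le k$ and $e\ge1$, the $(k,r)$-nested matching $M_e^{k,r}$ is the ordered $k$-uniform hypergraph on a set of integers (ordered as integers) defined iteratively: $M_1^{k,r}$ has the single edge $A_1=[k]$, and $M_{e+1}^{k,r}$ consists of the edges of $M_e^{k,r}$ together with an edge $A_{e+1}$ consisting of the $r$ least integers greater than $\max V(M_e^{k,r})$ and the $k-r$ greatest integers less than $\min V(M_e^{k,r})$. *)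

theory Defs
  imports "HOL-Library.Ramsey"
begin

text \<open>
  The total order on the vertices is that of the type, so the sets of integers and of natural
  numbers used below carry their natural orders.
\<close>

record 'a hypergraph =
  verts :: "'a set"
  edges :: "'a set set"

definition uniform_hypergraph :: "nat \<Rightarrow> 'a hypergraph \<Rightarrow> bool" where
  "uniform_hypergraph k G \<longleftrightarrow>
     finite (verts G) \<and> (\<forall>A\<in>edges G. A \<subseteq> verts G \<and> card A = k)"

definition contained_in :: "'a::linorder hypergraph \<Rightarrow> 'b::linorder hypergraph \<Rightarrow> bool" where
  "contained_in G H \<longleftrightarrow>
     (\<exists>f. inj_on f (verts G) \<and> mono_on (verts G) f \<and> f ` verts G \<subseteq> verts H \<and>
          (\<forall>A\<in>edges G. f ` A \<in> edges H))"

definition complete_hypergraph :: "nat \<Rightarrow> nat \<Rightarrow> nat hypergraph" where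
  "complete_hypergraph k N = \<lparr>verts = {1..N}, edges = nsets {1..N} k\<rparr>"

definition colour_class :: "('a set \<Rightarrow> nat) \<Rightarrow> nat \<Rightarrow> 'a hypergraph \<Rightarrow> 'a hypergraph" where
  "colour_class c j H = \<lparr>verts = verts H, edges = {A \<in> edges H. c A = j}\<rparr>"

definition ramsey_arrows :: "nat \<Rightarrow> nat \<Rightarrow> nat \<Rightarrow> (nat \<Rightarrow> 'a::linorder hypergraph) \<Rightarrow> bool" where
  "ramsey_arrows k t N G \<longleftrightarrow>
     (\<forall>c \<in> edges (complete_hypergraph k N) \<rightarrow> {1..t}.
        \<exists>j\<in>{1..t}. contained_in (G j) (colour_class c j (complete_hypergraph k N)))"

definition ordered_ramsey :: "nat \<Rightarrow> nat \<Rightarrow> (nat \<Rightarrow> 'a::linorder hypergraph) \<Rightarrow> nat" where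
  "ordered_ramsey k t G = (LEAST N. ramsey_arrows k t N G)"

text \<open>
  The parameter \<open>e\<close> is meant to be positive; the value at \<open>0\<close> is a dummy.
\<close>

fun nested_matching :: "nat \<Rightarrow> nat \<Rightarrow> nat \<Rightarrow> int hypergraph" where
  "nested_matching k r 0 = \<lparr>verts = {}, edges = {}\<rparr>"
| "nested_matching k r (Suc 0) = \<lparr>verts = {1..int k}, edges = {{1..int k}}\<rparr>"
| "nested_matching k r (Suc (Suc e)) =
     (let M = nested_matching k r (Suc e);
          A = {Max (verts M)<..Max (verts M) + int r} \<union>
              {Min (verts M) - int (k - r)..<Min (verts M)}
      in \<lparr>verts = verts M \<union> A, edges = insert A (edges M)\<rparr>)"

lemma verts_nested_matching_nonempty:
  assumes "k \<ge> 1" "e \<ge> 1"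
  shows "verts (nested_matching k r e) \<noteq> {}"
  using assms by (induction k r e rule: nested_matching.induct) (auto simp: Let_def)

lemma uniform_nested_matching:
  assumes "k \<ge> 1" "r \<le> k" "e \<ge> 1"
  shows "uniform_hypergraph k (nested_matching k r e)"
  using assms
proof (induction k r e rule: nested_matching.induct)
  case (3 k r e)
  let ?M = "nested_matching k r (Suc e)"
  have IH: "uniform_hypergraph k ?M"
    using "3.IH" "3.prems" by simp
  define a b where "a = Min (verts ?M)" and "b = Max (verts ?M)"
  define A where "A = {b<..b + int r} \<union> {a - int (k - r)..<a}"
  have "finite (verts ?M)" "verts ?M \<noteq> {}"
    using IH verts_nested_matching_nonempty[of k "Suc e" r] "3.prems"
    by (simp_all add: uniform_hypergraph_def)
  then have le: "a \<le> b"
    by (simp add: a_def b_def)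
  have "card A = card {b<..b + int r} + card {a - int (k - r)..<a}"
    unfolding A_def using le by (intro card_Un_disjoint) auto
  then have "card A = k"
    using "3.prems" by simp
  moreover have "nested_matching k r (Suc (Suc e)) =
      \<lparr>verts = verts ?M \<union> A, edges = insert A (edges ?M)\<rparr>"
    by (simp add: Let_def A_def a_def b_def)
  moreover have "finite A"
    by (simp add: A_def)
  ultimately show ?case
    using IH unfolding uniform_hypergraph_def by auto
qed (auto simp: uniform_hypergraph_def)

text \<open>
  By Ramsey's theorem the \<open>LEAST\<close> in \<^const>\<open>ordered_ramsey\<close> is attained whenever all
  the hypergraphs are \<open>k\<close>-uniform.
\<close>

lemma contained_in_if_card_le:
  fixes G :: "'a::linorder hypergraph" and S :: "nat set"
  assumes "uniform_hypergraph k G" "finite S" "card S = card (verts G)"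
    and "S \<subseteq> verts H" "nsets S k \<subseteq> edges H"
  shows "contained_in G H"
proof -
  let ?xs = "sorted_list_of_set (verts G)" and ?ys = "sorted_list_of_set S"
  have fin: "finite (verts G)" using assms by (simp add: uniform_hypergraph_def)
  have len: "length ?ys = length ?xs" using assms by simp
  define g where "g = (\<lambda>x. card {y \<in> verts G. y < x})"
  have g_less: "g x < card (verts G)" if "x \<in> verts G" for x
    unfolding g_def using that fin by (intro psubset_card_mono) auto
  have g_mono: "g x < g y" if "x \<in> verts G" "y \<in> verts G" "x < y" for x y
    unfolding g_def using that fin by (intro psubset_card_mono) auto
  define f where "f = (\<lambda>x. ?ys ! g x)"
  have sm: "f x < f y" if "x \<in> verts G" "y \<in> verts G" "x < y" for x y
    unfolding f_def using g_mono[OF that] g_less[OF that(2)] assms(3)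
    by (intro sorted_wrt_nth_less[OF strict_sorted_list_of_set]) auto
  have inj: "inj_on f (verts G)"
    by (intro linorder_inj_onI') (use sm in fastforce)+
  have mono: "mono_on (verts G) f"
    by (intro mono_onI) (metis sm order.order_iff_strict)
  have img: "f ` verts G \<subseteq> S"
  proof
    fix y assume "y \<in> f ` verts G"
    then obtain x where "x \<in> verts G" "y = ?ys ! g x" by (auto simp: f_def)
    then have "y \<in> set ?ys" using g_less assms(3) by auto
    then show "y \<in> S" using assms(2) by simp
  qed
  have "f ` A \<in> edges H" if "A \<in> edges G" for A
  proof -
    have A: "A \<subseteq> verts G" "card A = k" using that assms(1) by (auto simp: uniform_hypergraph_def)
    have "card (f ` A) = k" using A inj by (metis card_image inj_on_subset)
    moreover have "f ` A \<subseteq> S" using A img by blast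
    ultimately have "f ` A \<in> nsets S k" using assms(2) finite_subset by (auto simp: nsets_def)
    then show ?thesis using assms(5) by blast
  qed
  then show ?thesis
    unfolding contained_in_def using inj mono img assms(4) by blast
qed

lemma ex_ramsey_arrows:
  fixes G :: "nat \<Rightarrow> 'a::linorder hypergraph"
  assumes "\<And>i. i \<in> {1..t} \<Longrightarrow> uniform_hypergraph k (G i)"
  shows "\<exists>N. ramsey_arrows k t N G"
proof -
  define qs where "qs = map (\<lambda>i. card (verts (G (Suc i)))) [0..<t]"
  obtain N :: nat where N: "partn_lst {..<N} qs k"
    using ramsey_full by blast
  have "ramsey_arrows k t N G"
    unfolding ramsey_arrows_def
  proof
    fix c assume c: "c \<in> edges (complete_hypergraph k N) \<rightarrow> {1..t}"
    have Suc_nsets: "Suc ` A \<in> nsets (Suc ` S) k" if "A \<in> nsets S k" for A S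
      using that by (auto simp: nsets_def card_image)
    have Suc_img: "Suc ` {..<N} = {1..N}"
      by (auto simp: image_iff) (metis Suc_le_D Suc_le_lessD lessThan_iff)
    let ?f = "\<lambda>A. c (Suc ` A) - 1"
    have "?f \<in> nsets {..<N} k \<rightarrow> {..<t}"
    proof
      fix A assume "A \<in> nsets {..<N} k"
      then have "Suc ` A \<in> nsets {1..N} k" using Suc_nsets Suc_img by metis
      then have "c (Suc ` A) \<in> {1..t}" using c by (auto simp: complete_hypergraph_def)
      then show "?f A \<in> {..<t}" by auto
    qed
    then obtain i H where i: "i < t" and H: "H \<in> nsets {..<N} (qs ! i)"
        and mono: "?f ` nsets H k \<subseteq> {i}"
      using N by (elim partn_lstE[where l = t]) (auto simp: qs_def)
    let ?C = "colour_class c (Suc i) (complete_hypergraph k N)"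
    have S: "Suc ` H \<subseteq> {1..N}" using H Suc_img by (auto simp: nsets_def)
    have edge: "B \<in> edges ?C" if "B \<in> nsets (Suc ` H) k" for B
    proof -
      obtain A where A: "A \<subseteq> H" "B = Suc ` A"
        using \<open>B \<in> nsets (Suc ` H) k\<close> by (auto simp: nsets_def subset_image_iff)
      then have "A \<in> nsets H k"
        using that by (auto simp: nsets_def card_image finite_image_iff)
      then have "c B - 1 = i" using mono A by auto
      moreover have B: "B \<in> nsets {1..N} k" using that nsets_mono[OF S] by blast
      then have "c B \<ge> 1" using c by (auto simp: complete_hypergraph_def)
      ultimately show ?thesis using B by (auto simp: colour_class_def complete_hypergraph_def)
    qed
    have "contained_in (G (Suc i)) ?C"
    proof (rule contained_in_if_card_le)
      show "uniform_hypergraph k (G (Suc i))" using assms i by auto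
      show "finite (Suc ` H)" "card (Suc ` H) = card (verts (G (Suc i)))"
        using H i by (auto simp: nsets_def qs_def card_image)
      show "Suc ` H \<subseteq> verts ?C" using S by (auto simp: colour_class_def complete_hypergraph_def)
      show "nsets (Suc ` H) k \<subseteq> edges ?C" using edge by blast
    qed
    then show "\<exists>j\<in>{1..t}. contained_in (G j) (colour_class c j (complete_hypergraph k N))"
      using i by (intro bexI[of _ "Suc i"]) auto
  qed
  then show ?thesis ..
qed

end

theory Submission
  imports Defs
begin

text \<open>
  Write \<open>q = k - r\<close> and let \<open>T\<close> be the sum of the \<open>e\<^sub>i - 1\<close>.

  Upper bound: \<open>{1..k * (1 + T)}\<close> is the vertex set of a copy of the nested matching with
  \<open>T + 1\<close> edges. By pigeonhole some colour \<open>i\<close> receives at least \<open>e\<^sub>i\<close> of these edges,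
  and any \<open>e\<^sub>i\<close> edges of a nested matching form a nested matching again.

  Lower bound: take intervals \<open>B\<^sub>0 \<subseteq> \<dots> \<subseteq> B\<^sub>t\<close> where \<open>B\<^sub>0\<close> has \<open>k - 1\<close> vertices and \<open>B\<^sub>i\<close>
  extends \<open>B\<^bsub>i-1\<^esub>\<close> by \<open>q * (e\<^sub>i - 1)\<close> vertices on the left and \<open>r * (e\<^sub>i - 1)\<close> on the right, and
  give an edge the least colour \<open>i\<close> such that \<open>B\<^sub>i\<close> contains it. In a copy of the \<open>i\<close>-th matching of
  colour \<open>i\<close>, the innermost edge has a vertex outside \<open>B\<^bsub>i-1\<^esub>\<close>; on that side of \<open>B\<^sub>i\<close> there
  is then no room left for the other \<open>e\<^sub>i - 1\<close> edges.
\<close>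

section \<open>Explicit coordinates for nested matchings\<close>

text \<open>These are the edges counted from the inside, starting at \<open>m = 0\<close>, where the
  two blocks meet and form \<open>{1..q + r}\<close>.\<close>

definition layer :: "nat \<Rightarrow> nat \<Rightarrow> nat \<Rightarrow> int set" where
  "layer q r m = {- int (q * m) <.. int q - int (q * m)} \<union>
     {int q + int (r * m) <.. int q + int r + int (r * m)}"

text \<open>The vertex set stays a nonempty interval, so \<open>Max\<close> and \<open>Min\<close>
  are its endpoints and the recursion adds exactly the next layer.\<close>

lemma nested_matching_Suc:
  assumes "q + r \<ge> 1"
  shows "nested_matching (q + r) r (Suc n) =
    \<lparr>verts = {- int (q * n) <.. int q + int r + int (r * n)}, edges = layer q r ` {..n}\<rparr>"
proof (induction n)
  case 0
  have "layer q r 0 = {1..int (q + r)}" "{0<..int q + int r} = {1..int (q + r)}"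
    by (auto simp: layer_def)
  then show ?case by simp
next
  case (Suc n)
  let ?V = "{- int (q * n) <.. int q + int r + int (r * n)}"
  have ne: "- int (q * n) + 1 \<le> int q + int r + int (r * n)"
    using assms by linarith
  have V: "?V = {- int (q * n) + 1..int q + int r + int (r * n)}"
    by auto
  have Max: "Max ?V = int q + int r + int (r * n)"
    unfolding V using ne by (intro Max_eqI) auto
  have Min: "Min ?V = - int (q * n) + 1"
    unfolding V using ne by (intro Min_eqI) auto
  have A: "{Max ?V<..Max ?V + int r} \<union> {Min ?V - int (q + r - r)..<Min ?V} = layer q r (Suc n)"
    unfolding Max Min layer_def by auto
  have U: "?V \<union> layer q r (Suc n) = {- int (q * Suc n) <.. int q + int r + int (r * Suc n)}"
    using ne unfolding layer_def by auto
  show ?case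
    by (simp only: nested_matching.simps(3) Let_def Suc.IH hypergraph.simps A U)
       (simp add: atMost_Suc)
qed

section \<open>Moving a matching onto selected layers\<close>

text \<open>If \<open>J\<close> is listed increasingly, the gap between the \<open>m\<close>-th
  element and \<open>m\<close> never decreases. The choice is recorded by these gaps because they
  say how far \<open>spread\<close> moves each layer.\<close>

lemma ex_mono_shift_into:
  fixes J :: "nat set"
  assumes "finite J" "e \<le> card J"
  shows "\<exists>d. mono d \<and> (\<forall>m<e. m + d m \<in> J)"
  using assms
proof (induction e arbitrary: J)
  case 0
  then show ?case by (auto intro!: exI[of _ "\<lambda>_. 0"] monoI)
next
  case (Suc e)
  define x where "x = Max J"
  have x: "x \<in> J" "\<And>y. y \<in> J \<Longrightarrow> y \<le> x"
    using Suc.prems by (auto simp: x_def intro!: Max_in)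
  have "e \<le> card (J - {x})" "finite (J - {x})"
    using Suc.prems x by auto
  then obtain d where d: "mono d" "\<And>m. m < e \<Longrightarrow> m + d m \<in> J - {x}"
    using Suc.IH by meson
  have le: "d m \<le> x - e \<and> e \<le> x" if "m < e" for m
  proof -
    have "e - 1 + d (e - 1) < x"
      using d(2)[of "e - 1"] x(2)[of "e - 1 + d (e - 1)"] that by fastforce
    moreover have "d m \<le> d (e - 1)"
      using that by (intro monoD[OF d(1)]) auto
    ultimately show ?thesis using that by linarith
  qed
  \<comment> \<open>The constant value from \<open>e\<close> on sends \<open>e\<close> to the
    maximum \<open>x\<close> and keeps \<open>d'\<close> monotone on all naturals.\<close>
  define d' where "d' = (\<lambda>m. if m < e then d m else x - e)"
  have "mono d'"
    unfolding d'_def using le monoD[OF d(1)] by (intro monoI) auto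
  moreover have "m + d' m \<in> J" if "m < Suc e" for m
  proof (cases "m < e")
    case True
    then show ?thesis using d(2) by (auto simp: d'_def)
  next
    case False
    then have "m = e" using that by simp
    moreover have "e \<le> x" using le by (cases e) auto
    ultimately show ?thesis using x by (simp add: d'_def)
  qed
  ultimately show ?case by blast
qed

text \<open>
  A vertex in layer \<open>m\<close> is moved outwards into layer \<open>m + d m\<close>, on its own side of the centre.
\<close>

definition spread :: "nat \<Rightarrow> nat \<Rightarrow> (nat \<Rightarrow> nat) \<Rightarrow> int \<Rightarrow> int" where
  "spread q r d x =
     (if x > int q then x + int (r * d (nat ((x - int q - 1) div int r)))
      else x - int (q * d (nat ((int q - x) div int q))))"

text \<open>Shifts point outwards and do not shrink with the distance from the centre, so no gap
  between two points gets smaller.\<close>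

lemma strict_mono_spread:
  assumes "mono d"
  shows "strict_mono (spread q r d)"
proof (rule strict_monoI)
  fix x y :: int
  assume "x < y"
  have R: "d (nat ((x - int q - 1) div int r)) \<le> d (nat ((y - int q - 1) div int r))"
    \<comment> \<open>For \<open>r = 0\<close> both quotients are divisions by zero, hence
      \<open>0\<close>, and the two sides coincide.\<close>
    by (cases "r = 0") (use \<open>x < y\<close> in \<open>auto intro!: monoD[OF assms] nat_mono zdiv_mono1\<close>)
  have L: "d (nat ((int q - y) div int q)) \<le> d (nat ((int q - x) div int q))"
    by (cases "q = 0") (use \<open>x < y\<close> in \<open>auto intro!: monoD[OF assms] nat_mono zdiv_mono1\<close>)
  have "int (r * d (nat ((x - int q - 1) div int r))) \<le> int (r * d (nat ((y - int q - 1) div int r)))"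
    "int (q * d (nat ((int q - y) div int q))) \<le> int (q * d (nat ((int q - x) div int q)))"
    using R L by (simp_all only: of_nat_le_iff mult_le_mono2)
  moreover have "int (r * d (nat ((y - int q - 1) div int r))) \<ge> 0"
    "int (q * d (nat ((int q - x) div int q))) \<ge> 0"
    by (rule of_nat_0_le_iff)+
  ultimately show "spread q r d x < spread q r d y"
    unfolding spread_def using \<open>x < y\<close> by (simp only: split: if_split) linarith
qed

lemma nat_div_eqI:
  fixes x :: int
  assumes "int (n * m) \<le> x" "x < int n + int (n * m)"
  shows "nat (x div int n) = m"
proof -
  have "x div int n = int m"
    using assms by (intro int_div_pos_eq[of _ _ _ "x - int (n * m)"]) auto
  then show ?thesis by simp
qed

text \<open>On the left block \<open>q - x\<close> runs from \<open>q * m\<close> to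
  \<open>q * m + q - 1\<close>, on the right block \<open>x - q - 1\<close> from
  \<open>r * m\<close> to \<open>r * m + r - 1\<close>; so both quotients in \<open>spread\<close>
  are \<open>m\<close>.\<close>

lemma spread_layer: "spread q r d ` layer q r m = layer q r (m + d m)"
proof -
  let ?L = "{- int (q * m) <.. int q - int (q * m)}"
  let ?R = "{int q + int (r * m) <.. int q + int r + int (r * m)}"
  have L: "spread q r d x = x - int (q * d m)" if "x \<in> ?L" for x
  proof -
    have "nat ((int q - x) div int q) = m"
      using that by (intro nat_div_eqI) auto
    moreover have "\<not> x > int q"
      using that by auto (smt (verit) of_nat_0_le_iff zero_le_mult_iff)
    ultimately show ?thesis by (simp add: spread_def)
  qed
  have R: "spread q r d x = x + int (r * d m)" if "x \<in> ?R" for x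
  proof -
    have "nat ((x - int q - 1) div int r) = m"
      using that by (intro nat_div_eqI) auto
    moreover have "x > int q"
      using that by auto (smt (verit) of_nat_0_le_iff zero_le_mult_iff)
    ultimately show ?thesis by (simp add: spread_def)
  qed
  have "spread q r d ` ?L = (\<lambda>x. x + (- int (q * d m))) ` ?L"
    using L by (intro image_cong) auto
  also have "\<dots> = {- int (q * (m + d m)) <.. int q - int (q * (m + d m))}"
    by (auto simp: algebra_simps image_iff intro!: bexI[of _ "_ + int q * int (d m)"])
  finally have 1: "spread q r d ` ?L = \<dots>" .
  have "spread q r d ` ?R = (\<lambda>x. x + int (r * d m)) ` ?R"
    using R by (intro image_cong) auto
  also have "\<dots> = {int q + int (r * (m + d m)) <.. int q + int r + int (r * (m + d m))}"
    by (auto simp: algebra_simps image_iff intro!: bexI[of _ "_ - int r * int (d m)"])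
  finally have 2: "spread q r d ` ?R = \<dots>" .
  show ?thesis
    unfolding layer_def image_Un 1 2 ..
qed

lemma layer_subset:
  assumes "m \<le> n"
  shows "layer q r m \<subseteq> {- int (q * n) <.. int q + int r + int (r * n)}"
proof -
  have "int (q * m) \<le> int (q * n)" "int (r * m) \<le> int (r * n)"
    using assms by (simp_all only: of_nat_le_iff mult_le_mono2)
  moreover have "int (q * m) \<ge> 0" "int (r * m) \<ge> 0"
    by (rule of_nat_0_le_iff)+
  ultimately show ?thesis
    unfolding layer_def
    by (intro Un_least subsetI; unfold greaterThanAtMost_iff; linarith)
qed

lemma card_layer: "card (layer q r m) = q + r"
proof -
  have "int (q * m) \<ge> 0" "int (r * m) \<ge> 0"
    by (rule of_nat_0_le_iff)+
  then show ?thesis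
    unfolding layer_def by (subst card_Un_disjoint) (auto simp del: of_nat_mult)
qed

text \<open>Every vertex lies in an edge, so the image of the vertex set can be controlled edge by
  edge.\<close>

lemma verts_eq_Union_layers:
  "{- int (q * n) <.. int q + int r + int (r * n)} = (\<Union>m\<le>n. layer q r m)"
proof (induction n)
  case 0
  show ?case by (auto simp: layer_def)
next
  case (Suc n)
  have "{- int (q * Suc n) <.. int q + int r + int (r * Suc n)} =
      {- int (q * n) <.. int q + int r + int (r * n)} \<union> layer q r (Suc n)"
    unfolding layer_def
    by auto (smt (verit) of_nat_0_le_iff zero_le_mult_iff)+
  then show ?case unfolding Suc.IH by (auto simp: atMost_Suc)
qed

section \<open>Upper bound\<close>

lemma ramsey_arrows_nested_matching:
  fixes e :: "nat \<Rightarrow> nat"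
  assumes k: "q + r \<ge> 1" and e: "\<And>i. i \<in> {1..t} \<Longrightarrow> e i \<ge> 1"
  shows "ramsey_arrows (q + r) t ((q + r) * (1 + (\<Sum>i=1..t. e i - 1)))
    (\<lambda>i. nested_matching (q + r) r (e i))"
  unfolding ramsey_arrows_def
proof
  define T where "T = (\<Sum>i=1..t. e i - 1)"
  let ?N = "(q + r) * (1 + T)"
  fix c
  assume "c \<in> edges (complete_hypergraph (q + r) ((q + r) * (1 + (\<Sum>i=1..t. e i - 1)))) \<rightarrow> {1..t}"
  then have c: "c A \<in> {1..t}" if "A \<in> nsets {1..?N} (q + r)" for A
    using that by (auto simp: complete_hypergraph_def T_def)
  \<comment> \<open>This translation carries the \<open>T + 1\<close> layers onto
    \<open>{1..?N}\<close>; on \<open>?V\<close> the argument of \<open>nat\<close> is positive, so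
    nothing is cut off.\<close>
  define g where "g = (\<lambda>x. nat (x + int (q * T)))"
  let ?V = "{- int (q * T) <.. int q + int r + int (r * T)}"
  have g_less: "g x < g y" if "x \<in> ?V" "x < y" for x y
    using that unfolding g_def by auto
  have g_V: "g ` ?V \<subseteq> {1..?N}"
    unfolding g_def by (auto simp: algebra_simps le_nat_iff nat_le_iff)
  have g_inj: "inj_on g ?V"
    by (rule linorder_inj_onI') (use g_less in fastforce)
  have edge: "g ` layer q r m \<in> nsets {1..?N} (q + r)" if "m \<le> T" for m
  proof -
    have V: "layer q r m \<subseteq> ?V" using layer_subset[OF that] .
    have "card (g ` layer q r m) = q + r"
      using card_image[OF inj_on_subset[OF g_inj V]] card_layer by simp
    moreover have "g ` layer q r m \<subseteq> {1..?N}" using V g_V by blast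
    ultimately show ?thesis by (auto simp: nsets_def intro: finite_subset)
  qed
  define J where "J i = {m. m \<le> T \<and> c (g ` layer q r m) = i}" for i
  have fin: "finite (J i)" for i by (simp add: J_def)
  obtain i where i: "i \<in> {1..t}" "e i \<le> card (J i)"
  proof (rule ccontr)
    assume "\<not> thesis"
    then have lt: "card (J i) \<le> e i - 1" if "i \<in> {1..t}" for i
      using that \<open>\<And>i. i \<in> {1..t} \<Longrightarrow> e i \<le> card (J i) \<Longrightarrow> thesis\<close> by fastforce
    have "{..T} = (\<Union>i\<in>{1..t}. J i)"
      using c edge by (auto simp: J_def)
    then have "T + 1 \<le> (\<Sum>i=1..t. card (J i))"
      using card_UN_le[of "{1..t}" J] by (metis card_atMost finite_atLeastAtMost Suc_eq_plus1)
    also have "\<dots> \<le> T"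
      unfolding T_def by (rule sum_mono) (rule lt)
    finally show False by simp
  qed
  obtain d where d: "mono d" "\<And>m. m < e i \<Longrightarrow> m + d m \<in> J i"
    using ex_mono_shift_into[OF fin i(2)] by blast
  obtain n where n: "e i = Suc n"
    using e[OF i(1)] by (cases "e i") auto
  let ?H = "colour_class c i (complete_hypergraph (q + r) ?N)"
  let ?W = "{- int (q * n) <.. int q + int r + int (r * n)}"
  let ?f = "g \<circ> spread q r d"
  have W: "spread q r d ` ?W \<subseteq> ?V"
  proof
    fix y assume "y \<in> spread q r d ` ?W"
    then obtain m where m: "m \<le> n" "y \<in> layer q r (m + d m)"
      unfolding verts_eq_Union_layers image_UN spread_layer by blast
    then show "y \<in> ?V"
      using layer_subset[of "m + d m" T q r] d(2)[of m] n by (auto simp: J_def)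
  qed
  have f_less: "?f x < ?f y" if "x \<in> ?W" "y \<in> ?W" "x < y" for x y
    unfolding comp_def
    by (rule g_less[OF subsetD[OF W imageI[OF that(1)]] strict_monoD[OF strict_mono_spread[OF d(1)] that(3)]])
  have "inj_on ?f ?W"
    by (rule linorder_inj_onI') (use f_less in fastforce)
  moreover have "mono_on ?W ?f"
    by (intro mono_onI) (metis f_less order.order_iff_strict)
  moreover have "?f ` ?W \<subseteq> verts ?H"
    using W g_V by (auto simp: colour_class_def complete_hypergraph_def)
  moreover have "?f ` layer q r m \<in> edges ?H" if "m \<le> n" for m
    using d(2)[of m] that n edge unfolding image_comp[symmetric] spread_layer
    by (auto simp: J_def colour_class_def complete_hypergraph_def)
  ultimately have "contained_in (nested_matching (q + r) r (e i)) ?H"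
    unfolding contained_in_def n nested_matching_Suc[OF k] hypergraph.simps by blast
  then show "\<exists>j\<in>{1..t}. contained_in (nested_matching (q + r) r (e j))
      (colour_class c j (complete_hypergraph (q + r) ((q + r) * (1 + (\<Sum>i=1..t. e i - 1)))))"
    using i(1) unfolding T_def by blast
qed

section \<open>Lower bound\<close>

lemma not_ramsey_arrows_nested_matching:
  fixes e :: "nat \<Rightarrow> nat"
  assumes k: "q + r \<ge> 1" and e: "\<And>i. i \<in> {1..t} \<Longrightarrow> e i \<ge> 1"
    and N: "N < (q + r) * (1 + (\<Sum>i=1..t. e i - 1))"
  shows "\<not> ramsey_arrows (q + r) t N (\<lambda>i. nested_matching (q + r) r (e i))"
proof
  assume ramsey: "ramsey_arrows (q + r) t N (\<lambda>i. nested_matching (q + r) r (e i))"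
  define S where "S i = (\<Sum>j=1..i. e j - 1)" for i
  \<comment> \<open>Described from the outside: \<open>B t\<close> is
    \<open>{1..k * (1 + S t) - 1}\<close> with \<open>k = q + r\<close>, and \<open>B i\<close>
    arises from it by deleting \<open>q * (S t - S i)\<close> points on the left and
    \<open>r * (S t - S i)\<close> on the right.\<close>
  define B where "B i = {q * (S t - S i) <..< (q + r) * (1 + S t) - r * (S t - S i)}" for i
  have S_mono: "S i \<le> S j" if "i \<le> j" for i j
    unfolding S_def using that by (intro sum_mono2) auto
  have S_step: "S i = S (i - 1) + (e i - 1)" if "i \<in> {1..t}" for i
    using that by (cases i) (auto simp: S_def)
  \<comment> \<open>No edge fits into \<open>B 0\<close>, so the least index in \<open>c\<close> is
    never \<open>0\<close>.\<close>
  have cB0: "card (B 0) < q + r"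
  proof -
    have "(q + r) * (1 + S t) = q + r + r * S t + q * S t"
      by (simp add: add_mult_distrib add_mult_distrib2)
    moreover have "S 0 = 0" by (simp add: S_def)
    ultimately have "B 0 = {q * S t <..< q + r + r * S t + q * S t - r * S t}"
      by (simp only: B_def diff_zero)
    then show ?thesis using k by simp
  qed
  define c where "c A = (LEAST i. A \<subseteq> B i)" for A
  have c: "c A \<in> {1..t}" "A \<subseteq> B (c A)" "\<not> A \<subseteq> B (c A - 1)"
    if "A \<in> nsets {1..N} (q + r)" for A
  proof -
    have A: "A \<subseteq> {1..N}" "card A = q + r" using that by (auto simp: nsets_def)
    have At: "A \<subseteq> B t" using A(1) N by (auto simp: B_def S_def)
    then have "c A \<le> t" unfolding c_def by (rule Least_le)
    moreover show B: "A \<subseteq> B (c A)" unfolding c_def using At by (rule LeastI)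
    have "\<not> A \<subseteq> B 0"
      using card_mono[of "B 0" A] cB0 A(2) by (auto simp: B_def)
    then have "c A \<noteq> 0" using B by metis
    ultimately show "c A \<in> {1..t}" by auto
    show "\<not> A \<subseteq> B (c A - 1)"
      using \<open>c A \<noteq> 0\<close> unfolding c_def by (intro not_less_Least) auto
  qed
  have "c \<in> edges (complete_hypergraph (q + r) N) \<rightarrow> {1..t}"
    using c(1) by (auto simp: complete_hypergraph_def)
  then obtain i where i: "i \<in> {1..t}"
    and "contained_in (nested_matching (q + r) r (e i)) (colour_class c i (complete_hypergraph (q + r) N))"
    using ramsey unfolding ramsey_arrows_def by blast
  moreover obtain n where n: "e i = Suc n"
    using e[OF i] by (cases "e i") auto
  define W where "W = {- int (q * n) <.. int q + int r + int (r * n)}"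
  ultimately obtain f where inj: "inj_on f W" and mono: "mono_on W f"
    and edge: "\<And>m. m \<le> n \<Longrightarrow> f ` layer q r m \<in> nsets {1..N} (q + r) \<and> c (f ` layer q r m) = i"
    unfolding contained_in_def n nested_matching_Suc[OF k] W_def
    by (auto simp: colour_class_def complete_hypergraph_def)
  have f_less: "f x < f y" if "x \<in> W" "y \<in> W" "x < y" for x y
    using mono_onD[OF mono, of x y] inj_onD[OF inj, of x y] that by fastforce
  have fW: "f x \<in> B i" if "x \<in> W" for x
  proof -
    obtain m where "m \<le> n" "x \<in> layer q r m"
      using \<open>x \<in> W\<close> unfolding W_def verts_eq_Union_layers by blast
    then show ?thesis using c(2) edge by blast
  qed
  obtain x where x: "x \<in> layer q r 0" "f x \<notin> B (i - 1)"
    using c(3)[of "f ` layer q r 0"] edge[of 0] by auto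
  have nn: "int (q * n) \<ge> 0" "int (r * n) \<ge> 0"
    by (rule of_nat_0_le_iff)+
  have x_bounds: "0 < x" "x \<le> int q + int r"
    using x(1) by (auto simp: layer_def)
  then have xW: "x \<in> W" using nn unfolding W_def greaterThanAtMost_iff by linarith
  have le: "S (i - 1) \<le> S i" "S i \<le> S t" and Si: "S i = S (i - 1) + n"
    using S_mono[of i t] S_step[OF i] n i by auto
  define u where "u = S t - S i"
  have u: "S t - S (i - 1) = u + n" using le Si unfolding u_def by simp
  let ?b = "(q + r) * (1 + S t) - r * u"
  from x(2) consider "f x \<le> q * (u + n)" | "f x \<ge> ?b - r * n"
    unfolding B_def u by (fastforce simp: algebra_simps)
  then show False
  proof cases
    case 1
    \<comment> \<open>The left blocks of layers \<open>1\<close> to \<open>n\<close>. Their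
      \<open>q * n\<close> images lie strictly between \<open>q * u\<close> and \<open>f x\<close>,
      where at most \<open>q * n - 1\<close> places exist.\<close>
    let ?L = "{- int (q * n) <.. 0}"
    have L: "?L \<subseteq> W"
      unfolding W_def using nn by (intro subsetI; unfold greaterThanAtMost_iff; linarith)
    have "f ` ?L \<subseteq> {q * u <..< f x}"
    proof
      fix z assume "z \<in> f ` ?L"
      then obtain y where y: "y \<in> ?L" "z = f y" by blast
      then have "f y < f x" using L xW x_bounds by (intro f_less) auto
      moreover have "f y \<in> B i" using y L fW by blast
      ultimately show "z \<in> {q * u <..< f x}" using y unfolding B_def u_def by auto
    qed
    then have "card (f ` ?L) \<le> card {q * u <..< f x}" by (intro card_mono) auto
    moreover have "card (f ` ?L) = q * n"
      using card_image[OF inj_on_subset[OF inj L]] by (simp del: of_nat_mult)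
    ultimately have "q * n \<le> f x - Suc (q * u)" by simp
    \<comment> \<open>Excludes truncation in the preceding subtraction, which matters when
      \<open>q * n = 0\<close>.\<close>
    moreover have "f x > q * u" using fW[OF xW] unfolding B_def u_def by simp
    ultimately show False using 1 by (simp add: algebra_simps)
  next
    case 2
    \<comment> \<open>The mirror image: the right blocks of layers \<open>1\<close> to
      \<open>n\<close> need \<open>r * n\<close> places strictly between \<open>f x\<close> and
      \<open>?b\<close>.\<close>
    let ?R = "{int q + int r <.. int q + int r + int (r * n)}"
    have R: "?R \<subseteq> W"
      unfolding W_def using nn by (intro subsetI; unfold greaterThanAtMost_iff; linarith)
    have "f ` ?R \<subseteq> {f x <..< ?b}"
    proof
      fix z assume "z \<in> f ` ?R"
      then obtain y where y: "y \<in> ?R" "z = f y" by blast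
      then have "f x < f y" using R xW x_bounds by (intro f_less) auto
      moreover have "f y \<in> B i" using y R fW by blast
      ultimately show "z \<in> {f x <..< ?b}" using y unfolding B_def u_def by auto
    qed
    then have "card (f ` ?R) \<le> card {f x <..< ?b}" by (intro card_mono) auto
    moreover have "card (f ` ?R) = r * n"
      using card_image[OF inj_on_subset[OF inj R]] by (simp del: of_nat_mult)
    ultimately have "r * n \<le> ?b - Suc (f x)" by simp
    moreover have "f x < ?b" using fW[OF xW] unfolding B_def u_def by simp
    ultimately show False using 2 by linarith
  qed
qed

theorem theorem10:
  fixes k r t :: nat and e :: "nat \<Rightarrow> nat"
  assumes "k \<ge> 1"
    and "\<And>i. i \<in> {1..t} \<Longrightarrow> e i \<ge> 1"
    and "r \<le> k"
  shows "ordered_ramsey k t (\<lambda>i. nested_matching k r (e i)) = k * (1 + (\<Sum>i=1..t. (e i - 1)))"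
proof -
  obtain q where k: "k = q + r" using assms(3) le_Suc_ex by (metis add.commute)
  then have "q + r \<ge> 1" using assms(1) by simp
  then show ?thesis
    unfolding ordered_ramsey_def k using assms(2)
    by (intro Least_equality ramsey_arrows_nested_matching)
       (metis not_ramsey_arrows_nested_matching not_le)+
qed

end
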